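(* Let $m,n$ be positive integers and let $\mathcal{M}\in\mathbb{R}^{[2m,n]}$. Then: (i) if $\mathcal{M}$ is $T$-positive semidefinite, then $\mathcal{M}$ is $T$-column sufficient; (ii) if $\mathcal{M}$ is a $T$-$P$ tensor, then $\mathcal{M}$ is $T$-column sufficient; (iii) if $\mathcal{M}$ is $T$-copositive, then $\mathcal{M}$ is $T$-column sufficient on $\mathbb{R}^{[m,n]}_{+}$.
   Context: Write $[n]=\{1,\dots,n\}$. $\mathbb{R}^{[m,n]}$ denotes the set of $m$-th order $n$-dimensional real tensors $\mathcal{Z}=(z_{i_1\ldots i_m})$ with $i_j\in[n]$ for $j\in[m]$, and $\mathbb{R}^{[m,n]}_{+}$ the subset of tensors with all entries nonnegative; $\mathcal{O}$ is the zero tensor. For $\mathcal{M}=(m_{i_1\ldots i_{2m}})\in\mathbb{R}^{[2m,n]}$ and $\mathcal{Z}\in\mathbb{R}^{[m,n]}$, the tensor $\mathcal{M}\mathcal{Z}\in\mathbb{R}^{[m,n]}$ is defined by $(\mathcal{M}\mathcal{Z})_{i_1\ldots i_m}=\sum_{i_{m+1},\dots,i_{2m}=1}^n m_{i_1\ldots i_m i_{m+1}\ldots i_{2m}}z_{i_{m+1}\ldots i_{2m}}$, and $\mathcal{Z}(\mathcal{M}\mathcal{Z})=\sum_{i_1,\dots,i_m=1}^n z_{i_1\ldots i_m}(\mathcal{M}\mathcal{Z})_{i_1\ldots i_m}$ is the inner product of $\mathcal{Z}$ and $\mathcal{M}\mathcal{Z}$. For $\mathbb{K}\subseteq\mathbb{R}^{[m,n]}$,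 $\mathcal{M}\in\mathbb{R}^{[2m,n]}$ is $T$-column sufficient on $\mathbb{K}$ if for every $\mathcal{Z}\in\mathbb{K}$: if $z_{i_1\ldots i_m}(\mathcal{M}\mathcal{Z})_{i_1\ldots i_m}\le 0$ for all $i_1,\dots,i_m\in[n]$, then $z_{i_1\ldots i_m}(\mathcal{M}\mathcal{Z})_{i_1\ldots i_m}=0$ for all $i_1,\dots,i_m\in[n]$. $\mathcal{M}$ is $T$-column sufficient if it is so on $\mathbb{K}=\mathbb{R}^{[m,n]}$. $\mathcal{M}$ is $T$-positive semidefinite if $\mathcal{Z}(\mathcal{M}\mathcal{Z})\ge 0$ for all $\mathcal{Z}\in\mathbb{R}^{[m,n]}$; $T$-copositive if $\mathcal{Z}(\mathcal{M}\mathcal{Z})\ge 0$ for all $\mathcal{Z}\in\mathbb{R}^{[m,n]}_{+}$; a $T$-$P$ tensor if for every $\mathcal{Z}\in\mathbb{R}^{[m,n]}\setminus\{\mathcal{O}\}$ there exist $i_1,\dots,i_m\in[n]$ with $z_{i_1\ldots i_m}(\mathcal{M}\mathcal{Z})_{i_1\ldots i_m}>0$. *)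

theory Defs
  imports Complex_Main
begin

definition multi_index :: "nat \<Rightarrow> nat \<Rightarrow> nat list set" where
  "multi_index m n = {is. length is = m \<and> set is \<subseteq> {1..n}}"

text \<open>The tensor entry \<open>z\<^bsub>i\<^sub>1\<dots>i\<^sub>m\<^esub>\<close> is \<open>Z [i\<^sub>1, \<dots>, i\<^sub>m]\<close>.  Entries at lists that are not
  valid multi-indices are fixed to 0, so that equality of elements of \<open>tensors m n\<close> is
  entrywise equality and the zero tensor is the constant function 0.\<close>

type_synonym tensor = "nat list \<Rightarrow> real"

definition tensors :: "nat \<Rightarrow> nat \<Rightarrow> tensor set" where
  "tensors m n = {Z. \<forall>is. is \<notin> multi_index m n \<longrightarrow> Z is = 0}"

definition nonneg_tensors :: "nat \<Rightarrow> nat \<Rightarrow> tensor set" where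
  "nonneg_tensors m n = {Z \<in> tensors m n. \<forall>is \<in> multi_index m n. Z is \<ge> 0}"

definition zero_tensor :: tensor where
  "zero_tensor = (\<lambda>is. 0)"

text \<open>In the following definitions \<open>M\<close> has order \<open>2 * m\<close>; its index
  \<open>i\<^sub>1 \<dots> i\<^sub>m i\<^bsub>m+1\<^esub> \<dots> i\<^bsub>2m\<^esub>\<close> is the concatenation \<open>is @ js\<close> of two multi-indices of length \<open>m\<close>.\<close>

definition tensor_apply :: "nat \<Rightarrow> nat \<Rightarrow> tensor \<Rightarrow> tensor \<Rightarrow> tensor" where
  "tensor_apply m n M Z =
     (\<lambda>is. if is \<in> multi_index m n then \<Sum>js \<in> multi_index m n. M (is @ js) * Z js else 0)"

definition tensor_inner :: "nat \<Rightarrow> nat \<Rightarrow> tensor \<Rightarrow> tensor \<Rightarrow> real" where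
  "tensor_inner m n Y Z = (\<Sum>is \<in> multi_index m n. Y is * Z is)"

definition T_column_sufficient_on :: "nat \<Rightarrow> nat \<Rightarrow> tensor set \<Rightarrow> tensor \<Rightarrow> bool" where
  "T_column_sufficient_on m n K M \<longleftrightarrow>
     (\<forall>Z \<in> K. (\<forall>is \<in> multi_index m n. Z is * tensor_apply m n M Z is \<le> 0) \<longrightarrow>
              (\<forall>is \<in> multi_index m n. Z is * tensor_apply m n M Z is = 0))"

definition T_column_sufficient :: "nat \<Rightarrow> nat \<Rightarrow> tensor \<Rightarrow> bool" where
  "T_column_sufficient m n M \<longleftrightarrow> T_column_sufficient_on m n (tensors m n) M"

definition T_positive_semidefinite :: "nat \<Rightarrow> nat \<Rightarrow> tensor \<Rightarrow> bool" where
  "T_positive_semidefinite m n M \<longleftrightarrow>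
     (\<forall>Z \<in> tensors m n. tensor_inner m n Z (tensor_apply m n M Z) \<ge> 0)"

definition T_copositive :: "nat \<Rightarrow> nat \<Rightarrow> tensor \<Rightarrow> bool" where
  "T_copositive m n M \<longleftrightarrow>
     (\<forall>Z \<in> nonneg_tensors m n. tensor_inner m n Z (tensor_apply m n M Z) \<ge> 0)"

definition T_P_tensor :: "nat \<Rightarrow> nat \<Rightarrow> tensor \<Rightarrow> bool" where
  "T_P_tensor m n M \<longleftrightarrow>
     (\<forall>Z \<in> tensors m n - {zero_tensor}.
        \<exists>is \<in> multi_index m n. Z is * tensor_apply m n M Z is > 0)"

text \<open>Finiteness guards against \<open>sum\<close> over an infinite index set silently being 0.\<close>

lemma finite_multi_index [simp]: "finite (multi_index m n)"
proof -
  have "multi_index m n = {is. set is \<subseteq> {1..n} \<and> length is = m}"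
    by (auto simp: multi_index_def)
  then show ?thesis
    by (simp only: finite_lists_length_eq finite_atLeastAtMost)
qed

lemma append_in_multi_index:
  "is \<in> multi_index m n \<Longrightarrow> js \<in> multi_index m n \<Longrightarrow> is @ js \<in> multi_index (2 * m) n"
  by (auto simp: multi_index_def)

lemma tensor_apply_in_tensors: "tensor_apply m n M Z \<in> tensors m n"
  by (simp add: tensor_apply_def tensors_def)

end

theory Submission
  imports Defs
begin

text \<open>The inner product of \<open>Z\<close> with \<open>M Z\<close> is the sum of the entrywise products occurring in the
  definition of column sufficiency. If all these products are nonpositive while their sum is
  nonnegative, each of them vanishes; this covers positive semidefinite and copositive tensors,
  which differ only in the set of \<open>Z\<close> considered. For a \<open>T\<close>-\<open>P\<close> tensor, nonpositivity of all the
  products is possible only for the zero tensor, whose products vanish trivially.\<close>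

lemma T_column_sufficient_on_if_inner_nonneg:
  assumes "\<And>Z. Z \<in> K \<Longrightarrow> tensor_inner m n Z (tensor_apply m n M Z) \<ge> 0"
  shows "T_column_sufficient_on m n K M"
  unfolding T_column_sufficient_on_def
proof (rule ballI, rule impI)
  fix Z
  let ?p = "\<lambda>is. Z is * tensor_apply m n M Z is"
  assume "Z \<in> K" and nonpos: "\<forall>is \<in> multi_index m n. ?p is \<le> 0"
  have "sum ?p (multi_index m n) \<ge> 0"
    using assms[OF \<open>Z \<in> K\<close>] by (simp add: tensor_inner_def)
  moreover have "sum ?p (multi_index m n) \<le> 0"
    using nonpos by (intro sum_nonpos) auto
  ultimately have "sum ?p (multi_index m n) = 0"
    by linarith
  then show "\<forall>is \<in> multi_index m n. ?p is = 0"
    using nonpos sum_nonneg_eq_0_iff[of "multi_index m n" "\<lambda>is. - ?p is"]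
    by (simp add: sum_negf)
qed

lemma T_column_sufficient_if_T_P_tensor:
  assumes "T_P_tensor m n M"
  shows "T_column_sufficient m n M"
  unfolding T_column_sufficient_def T_column_sufficient_on_def
proof (rule ballI, rule impI)
  fix Z
  assume "Z \<in> tensors m n"
    and "\<forall>is \<in> multi_index m n. Z is * tensor_apply m n M Z is \<le> 0"
  then have "Z = zero_tensor"
    using assms by (force simp: T_P_tensor_def)
  then show "\<forall>is \<in> multi_index m n. Z is * tensor_apply m n M Z is = 0"
    by (simp add: zero_tensor_def)
qed

theorem proposition3p6:
  fixes m n :: nat and M :: tensor
  assumes "m > 0" and "n > 0"
    and "M \<in> tensors (2 * m) n"
  shows "(T_positive_semidefinite m n M \<longrightarrow> T_column_sufficient m n M) \<and>
         (T_P_tensor m n M \<longrightarrow> T_column_sufficient m n M) \<and>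
         (T_copositive m n M \<longrightarrow> T_column_sufficient_on m n (nonneg_tensors m n) M)"
proof (intro conjI impI)
  assume "T_positive_semidefinite m n M"
  then show "T_column_sufficient m n M"
    unfolding T_column_sufficient_def T_positive_semidefinite_def
    by (intro T_column_sufficient_on_if_inner_nonneg) blast
next
  assume "T_P_tensor m n M"
  then show "T_column_sufficient m n M"
    by (rule T_column_sufficient_if_T_P_tensor)
next
  assume "T_copositive m n M"
  then show "T_column_sufficient_on m n (nonneg_tensors m n) M"
    unfolding T_copositive_def
    by (intro T_column_sufficient_on_if_inner_nonneg) blast
qed

end
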